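(* For every odd integer $t \geq 3$ and every positive integer $k \equiv 0 \pmod 4$, the graph $K_{k+1} \times K_t$ has a partial $C_k$-factorization.
   Context: For graphs $G,H$, the tensor product $G \times H$ has vertex set $V(G)\times V(H)$, with $(g_1,h_1)$ adjacent to $(g_2,h_2)$ iff $g_1g_2 \in E(G)$ and $h_1h_2 \in E(H)$. $K_n$ is the complete graph on $n$ vertices. $K_{u} \times K_t$ is regarded as a $u$-partite graph with partite sets $V_i = \{i\}\times V(K_t)$. A partial $C_k$-factor of $K_u \times K_t$ is a subgraph which, for some $i$, is a spanning subgraph of $(K_u \times K_t)\setminus V_i$ all of whose components are cycles of length $k$; a partial $C_k$-factorization is a partition of the edge set into partial $C_k$-factors. *)

theory Defs
  imports "Graph_Theory.Graph_Theory" "HOL-Library.Disjoint_Sets"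
begin

text \<open>
  Finite simple graphs are represented as in Graph\_Theory, as finite loop-free symmetric digraphs
  (\<^locale>\<open>pair_graph\<close>): an undirected edge is the pair of opposite arcs between its ends. The
  components of such a graph are its strongly connected components.
\<close>

definition complete_graph :: "nat \<Rightarrow> nat pair_pre_digraph" where
  "complete_graph n =
    \<lparr> pverts = {..<n}, parcs = {(i, j). i < n \<and> j < n \<and> i \<noteq> j} \<rparr>"

lemma complete_digraph_complete_graph: "complete_digraph n (with_proj (complete_graph n))"
  unfolding complete_digraph_pair_def by (auto simp: complete_graph_def)

text \<open>The graph \<open>C\<^sub>k\<close>; it is meaningful only for \<open>k \<ge> 3\<close>.\<close>

definition cycle_graph :: "nat \<Rightarrow> nat pair_pre_digraph" where
  "cycle_graph k =
    \<lparr> pverts = {..<k},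
      parcs = {(i, j). i < k \<and> j < k \<and> (j = (i + 1) mod k \<or> i = (j + 1) mod k)} \<rparr>"

definition tensor_product ::
  "'a pair_pre_digraph \<Rightarrow> 'b pair_pre_digraph \<Rightarrow> ('a \<times> 'b) pair_pre_digraph" where
  "tensor_product G H =
    \<lparr> pverts = pverts G \<times> pverts H,
      parcs = {((g1, h1), (g2, h2)) | g1 h1 g2 h2. (g1, g2) \<in> parcs G \<and> (h1, h2) \<in> parcs H} \<rparr>"

definition partite_set :: "'b pair_pre_digraph \<Rightarrow> 'a \<Rightarrow> ('a \<times> 'b) set" where
  "partite_set H i = {i} \<times> pverts H"

text \<open>
  \<open>pair_graph F\<close> forces \<open>F\<close> to contain both arcs of each of its edges, so that \<open>F\<close> is
  a subgraph in the undirected sense.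
\<close>

definition partial_cycle_factor ::
  "nat \<Rightarrow> 'a pair_pre_digraph \<Rightarrow> 'b pair_pre_digraph \<Rightarrow> ('a \<times> 'b) pair_pre_digraph \<Rightarrow> bool" where
  "partial_cycle_factor k G H F \<longleftrightarrow>
    pair_graph F \<and>
    (\<exists>i \<in> pverts G.
      spanning (with_proj F)
        (with_proj (tensor_product G H)
          \<restriction> (pverts (tensor_product G H) - partite_set H i))) \<and>
    (\<forall>C \<in> pre_digraph.sccs (with_proj F). digraph_iso C (with_proj (cycle_graph k)))"

definition partial_cycle_factorization ::
  "nat \<Rightarrow> 'a pair_pre_digraph \<Rightarrow> 'b pair_pre_digraph \<Rightarrow> ('a \<times> 'b) pair_pre_digraph set \<Rightarrow> bool" where
  "partial_cycle_factorization k G H \<F> \<longleftrightarrow>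
    (\<forall>F \<in> \<F>. partial_cycle_factor k G H F) \<and>
    disjoint_family_on parcs \<F> \<and>
    (\<Union>F \<in> \<F>. parcs F) = parcs (tensor_product G H)"

end

theory Submission
  imports Defs
begin

text \<open>
  For \<open>k = 4m\<close>, the cycle \<open>C\<^sub>k\<close> has an \<open>\<alpha>\<close>-labelling (Rosa): its vertices carry distinct labels
  in \<open>{0,\<dots>,k}\<close>, omitting only \<open>3m\<close>, such that the even positions carry the small labels and the
  edges, oriented from even to odd positions, have the differences \<open>1,\<dots>,k\<close>, each exactly once.
  Modulo \<open>k + 1\<close>, the translates of this oriented cycle therefore cover every ordered pair of
  distinct residues exactly once.

  Write \<open>t = 2h + 1\<close>. For a translation \<open>i\<close> and \<open>1 \<le> d \<le> h\<close>, lift the cycle to \<open>K\<^sub>k\<^sub>+\<^sub>1 \<times> K\<^sub>t\<close> by adding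
  \<open>d\<close> modulo \<open>t\<close> to the second coordinate along every oriented edge. Orientations alternate around
  the cycle, so each lift closes up after \<open>k\<close> steps, and the \<open>t\<close> lifts form a partial \<open>C\<^sub>k\<close>-factor
  missing the part \<open>i + 3m\<close>. For \<open>y \<noteq> z\<close> exactly one of \<open>z - y\<close>, \<open>y - z\<close> is congruent to some
  \<open>d \<in> {1,\<dots>,h}\<close>; this orients every edge of \<open>K\<^sub>k\<^sub>+\<^sub>1 \<times> K\<^sub>t\<close> and determines its \<open>d\<close>, and then its \<open>i\<close>.
\<close>

section \<open>Vertex-disjoint unions of cycles\<close>

definition cycle_union :: "nat \<Rightarrow> 'x set \<Rightarrow> ('x \<Rightarrow> nat \<Rightarrow> 'v) \<Rightarrow> 'v pair_pre_digraph" where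
  "cycle_union k X f =
    \<lparr> pverts = {f x p | x p. x \<in> X \<and> p < k},
      parcs = {(f x p, f x q) | x p q. x \<in> X \<and> (p, q) \<in> parcs (cycle_graph k)} \<rparr>"

lemma pverts_cycle_union: "pverts (cycle_union k X f) = {f x p | x p. x \<in> X \<and> p < k}"
  by (simp add: cycle_union_def)

lemma parcs_cycle_union:
  "parcs (cycle_union k X f) = {(f x p, f x q) | x p q. x \<in> X \<and> (p, q) \<in> parcs (cycle_graph k)}"
  by (simp add: cycle_union_def)

lemma cycle_graph_arcD:
  assumes "(p, q) \<in> parcs (cycle_graph k)"
  shows "p < k" "q < k" "(q, p) \<in> parcs (cycle_graph k)"
  using assms by (auto simp: cycle_graph_def)

lemma cycle_graph_arc_neq:
  assumes "(p, q) \<in> parcs (cycle_graph k)" and "k \<ge> 2"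
  shows "p \<noteq> q"
  using assms by (auto simp: cycle_graph_def mod_Suc split: if_splits)

text \<open>Joint injectivity of \<open>f\<close> in both arguments makes the cycles vertex-disjoint
  and keeps the positions on each of them distinct; \<open>k \<ge> 2\<close> rules out
  loops.\<close>

locale disjoint_cycles =
  fixes k :: nat and X :: "'x set" and f :: "'x \<Rightarrow> nat \<Rightarrow> 'v"
  assumes length_ge_2: "k \<ge> 2" and finite_index: "finite X"
    and inj: "\<And>x p y q. x \<in> X \<Longrightarrow> y \<in> X \<Longrightarrow> p < k \<Longrightarrow> q < k \<Longrightarrow> f x p = f y q \<Longrightarrow> x = y \<and> p = q"
begin

lemma pair_graph_cycle_union: "pair_graph (cycle_union k X f)"
proof -
  have fv: "finite (pverts (cycle_union k X f))"
  proof -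
    have "pverts (cycle_union k X f) = case_prod f ` (X \<times> {..<k})"
      by (auto simp: pverts_cycle_union)
    then show ?thesis using finite_index by simp
  qed
  have sub: "parcs (cycle_union k X f) \<subseteq> pverts (cycle_union k X f) \<times> pverts (cycle_union k X f)"
    by (auto simp: pverts_cycle_union parcs_cycle_union dest: cycle_graph_arcD)
  show ?thesis
  proof
    show "fst e \<in> pverts (cycle_union k X f)" "snd e \<in> pverts (cycle_union k X f)"
      if "e \<in> parcs (cycle_union k X f)" for e
      using that sub by auto
    show "finite (parcs (cycle_union k X f))"
      using sub fv by (meson finite_SigmaI finite_subset)
    show "fst e \<noteq> snd e" if "e \<in> parcs (cycle_union k X f)" for e
    proof -
      from that obtain x p q where "e = (f x p, f x q)" "x \<in> X" and pq: "(p, q) \<in> parcs (cycle_graph k)"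
        by (auto simp: parcs_cycle_union)
      then show ?thesis
        using inj cycle_graph_arcD(1,2)[OF pq] cycle_graph_arc_neq[OF pq length_ge_2] by auto
    qed
    show "symmetric (with_proj (cycle_union k X f))"
      unfolding symmetric_def by (rule symI) (auto simp: parcs_cycle_union dest: cycle_graph_arcD(3))
  qed (rule fv)
qed

text \<open>Arcs never change the index of a cycle and each cycle is connected, so a component is
  exactly one indexed cycle. Inverting \<open>f x\<close> recovers the positions and yields the
  isomorphism.\<close>

lemma scc_cycle_union_iso_cycle:
  assumes C: "C \<in> pre_digraph.sccs (with_proj (cycle_union k X f))"
  shows "digraph_iso C (with_proj (cycle_graph k))"
proof -
  let ?F = "cycle_union k X f"
  interpret pair_graph ?F by (rule pair_graph_cycle_union)
  obtain S where S: "S \<in> sccs_verts" and C_eq: "C = with_proj ?F \<restriction> S"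
    using C unfolding sccs_conv_sccs_verts by auto
  obtain v where v: "v \<in> S" using S by (auto simp: sccs_verts_def)
  have SV: "S \<subseteq> pverts ?F"
    using S v unfolding in_sccs_verts_conv_reachable by (meson reachable_in_verts subsetI)
  then obtain x p where x: "x \<in> X" and p: "p < k" and vx: "v = f x p"
    using v by (auto simp: pverts_cycle_union)
  have stay: "w \<in> f x ` {..<k}" if "v \<rightarrow>\<^sup>*\<^bsub>?F\<^esub> w" for w
    using that
  proof (induction rule: reachable_induct)
    case base
    then show ?case using p vx by auto
  next
    case (step y z)
    from step.hyps obtain x' q r where *: "y = f x' q" "z = f x' r" "x' \<in> X"
      and qr: "(q, r) \<in> parcs (cycle_graph k)"
      by (auto simp: parcs_cycle_union)
    from step.IH obtain q' where "y = f x q'" "q' < k" by auto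
    then have "x' = x" using inj x * cycle_graph_arcD[OF qr] by metis
    then show ?case using * cycle_graph_arcD[OF qr] by auto
  qed
  have from0: "f x 0 \<rightarrow>\<^sup>*\<^bsub>?F\<^esub> f x q" if "q < k" for q
    using that
  proof (induction q)
    case 0
    then show ?case using x by (intro reachable_refl) (auto simp: pverts_cycle_union)
  next
    case (Suc q)
    then have "(f x q, f x (Suc q)) \<in> parcs ?F"
      using x by (auto simp: parcs_cycle_union cycle_graph_def intro!: exI)
    then show ?case using Suc by (meson Suc_lessD reachable_adjI reachable_trans)
  qed
  \<comment> \<open>Arcs come in opposite pairs, so the path from position 0 to \<open>q\<close> can
    be reversed and continued to \<open>r\<close>.\<close>
  have conn: "f x q \<rightarrow>\<^sup>*\<^bsub>?F\<^esub> f x r" if "q < k" "r < k" for q r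
    using from0[OF that(1)] from0[OF that(2)] symmetric_reachable' reachable_trans by blast
  have S_eq: "S = f x ` {..<k}"
  proof
    show "S \<subseteq> f x ` {..<k}"
      using S v stay unfolding in_sccs_verts_conv_reachable by blast
    show "f x ` {..<k} \<subseteq> S"
    proof
      fix w assume "w \<in> f x ` {..<k}"
      then have "v \<rightarrow>\<^sup>*\<^bsub>?F\<^esub> w" "w \<rightarrow>\<^sup>*\<^bsub>?F\<^esub> v" using conn p vx by auto
      then show "w \<in> S" using S v unfolding in_sccs_verts_conv_reachable by blast
    qed
  qed
  define g where "g = the_inv_into {..<k} (f x)"
  have injx: "inj_on (f x) {..<k}" using inj x by (auto intro!: inj_onI)
  have g: "g (f x q) = q" if "q < k" for q
    unfolding g_def using that injx by (simp add: the_inv_into_f_f)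
  have arcsC: "arcs C = (\<lambda>(q, r). (f x q, f x r)) ` parcs (cycle_graph k)"
  proof
    show "arcs C \<subseteq> (\<lambda>(q, r). (f x q, f x r)) ` parcs (cycle_graph k)"
    proof
      fix e assume "e \<in> arcs C"
      then have e: "e \<in> parcs ?F" "fst e \<in> f x ` {..<k}" by (auto simp: C_eq S_eq)
      then obtain y q r where *: "e = (f y q, f y r)" "y \<in> X" "(q, r) \<in> parcs (cycle_graph k)"
        by (auto simp: parcs_cycle_union)
      moreover obtain s where "f y q = f x s" "s < k" using e(2) * by auto
      ultimately have "y = x" using inj x cycle_graph_arcD(1) by metis
      then show "e \<in> (\<lambda>(q, r). (f x q, f x r)) ` parcs (cycle_graph k)" using * by auto
    qed
    show "(\<lambda>(q, r). (f x q, f x r)) ` parcs (cycle_graph k) \<subseteq> arcs C"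
      using x by (auto simp: C_eq S_eq parcs_cycle_union dest: cycle_graph_arcD)
  qed
  let ?h = "\<lparr> iso_verts = g, iso_arcs = map_prod g g, iso_head = snd, iso_tail = fst \<rparr>"
  have vertsC: "verts C = f x ` {..<k}" by (simp add: C_eq S_eq)
  have projC: "tail C = fst" "head C = snd" by (simp_all add: C_eq)
  have injg: "inj_on g (f x ` {..<k})"
    using g by (auto intro!: inj_onI)
  have subC: "arcs C \<subseteq> (f x ` {..<k}) \<times> (f x ` {..<k})"
    by (auto simp: arcsC dest: cycle_graph_arcD)
  have gg: "map_prod g g (f x q, f x r) = (q, r)" if "(q, r) \<in> parcs (cycle_graph k)" for q r
    using g cycle_graph_arcD[OF that] by simp
  have "wf_digraph C"
    unfolding C_eq using wf_digraph.wellformed_induce_subgraph wf_digraph by blast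
  then have "pre_digraph.digraph_isomorphism C ?h"
    unfolding pre_digraph.digraph_isomorphism_def
    using injg inj_on_subset[OF map_prod_inj_on[OF injg injg] subC] by (simp add: vertsC projC)
  moreover have "with_proj (cycle_graph k) = app_iso ?h C"
  proof (rule pre_digraph.equality)
    have "g ` f x ` {..<k} = {..<k}" using g by (force simp: image_image)
    then show "verts (with_proj (cycle_graph k)) = verts (app_iso ?h C)"
      by (simp add: vertsC cycle_graph_def)
    show "arcs (with_proj (cycle_graph k)) = arcs (app_iso ?h C)"
      using gg by (force simp: arcsC image_image case_prod_beta)
  qed simp_all
  ultimately show ?thesis unfolding digraph_iso_def by blast
qed

end

section \<open>Rosa's labelling and its edge differences\<close>

text \<open>
  Rosa's \<open>\<alpha>\<close>-labelling \<open>0, k, 1, k - 1, 2, \<dots>\<close>; the large labels skip one value half-way so that the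
  difference \<open>k/2\<close> is left for the closing edge.
\<close>

definition zigzag :: "nat \<Rightarrow> nat \<Rightarrow> nat" where
  "zigzag k p =
    (if even p then p div 2 else if 2 * p < k then k - p div 2 else k - 1 - p div 2)"

text \<open>For even \<open>k\<close> the parity of positions gives the bipartition of the cycle, so
  every edge contributes exactly one of its two arcs.\<close>

definition up_arcs :: "nat \<Rightarrow> (nat \<times> nat) set" where
  "up_arcs k = {(p, q) \<in> parcs (cycle_graph k). even p \<and> odd q}"

text \<open>An odd \<open>q\<close> is never the wrapped value 0, so wrapping happens only at
  \<open>p\<close>, in the closing arc from 0 to \<open>k - 1\<close>.\<close>

lemma up_arcs_iff:
  assumes "even k" "k > 0"
  shows "(p, q) \<in> up_arcs k \<longleftrightarrow>
    p < k \<and> q < k \<and> even p \<and> odd q \<and> (q = p + 1 \<or> p = q + 1 \<or> p = 0 \<and> q = k - 1)"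
proof -
  have "p = (q + 1) mod k \<longleftrightarrow> p = q + 1 \<or> p = 0 \<and> q = k - 1" if "q < k" "p < k"
    using that by (auto simp: mod_Suc)
  moreover have "q = (p + 1) mod k \<longleftrightarrow> q = p + 1" if "q < k" "p < k" "even p" "odd q"
    using that by (auto simp: mod_Suc odd_pos)
  ultimately show ?thesis by (auto simp: up_arcs_def cycle_graph_def)
qed

lemma cycle_graph_arc_cases:
  assumes "even k" and "(p, q) \<in> parcs (cycle_graph k)"
  shows "(p, q) \<in> up_arcs k \<or> (q, p) \<in> up_arcs k"
  using assms by (auto simp: up_arcs_def cycle_graph_def mod_Suc split: if_splits)

lemma zigzag_le: "p < k \<Longrightarrow> zigzag k p \<le> k"
  by (auto simp: zigzag_def)

context
  fixes k m :: nat
  assumes k: "k = 4 * m" and m: "m > 0"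
begin

lemma zigzag_even: "zigzag k (2 * a) = a"
  by (simp add: zigzag_def)

lemma zigzag_odd: "zigzag k (2 * a + 1) = (if a < m then k - a else k - 1 - a)"
  by (auto simp: zigzag_def k)

lemma inj_on_zigzag: "inj_on (zigzag k) {..<k}"
  using m unfolding k by (intro inj_onI) (auto simp: zigzag_def elim!: evenE oddE split: if_splits)

text \<open>Even positions carry 0 to 2m - 1; odd positions carry 4m down to 3m + 1 in the first
  half of the cycle and 3m - 1 down to 2m in the second.\<close>

lemma image_zigzag: "zigzag k ` {..<k} = {..k} - {3 * m}"
proof (intro equalityI subsetI)
  fix v assume "v \<in> zigzag k ` {..<k}"
  then show "v \<in> {..k} - {3 * m}"
    using m unfolding k by (auto simp: zigzag_def elim!: evenE oddE split: if_splits)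
next
  fix v assume v: "v \<in> {..k} - {3 * m}"
  consider "v < 2 * m" | "v > 3 * m" | "2 * m \<le> v" "v < 3 * m" using v by force
  then show "v \<in> zigzag k ` {..<k}"
  proof cases
    case 1
    then show ?thesis by (intro image_eqI[of _ _ "2 * v"]) (auto simp: zigzag_def k)
  next
    case 2
    then show ?thesis using v by (intro image_eqI[of _ _ "2 * (k - v) + 1"]) (auto simp: zigzag_def k)
  next
    case 3
    then show ?thesis by (intro image_eqI[of _ _ "2 * (k - 1 - v) + 1"]) (auto simp: zigzag_def k)
  qed
qed

text \<open>Rising, falling and closing arcs. Even the closing arc has its ends in the shapes
  \<open>2 * a\<close> and \<open>2 * a + 1\<close>, so that \<open>zigzag_even\<close> and
  \<open>zigzag_odd\<close> rewrite the labels.\<close>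

lemma up_arcs_cases:
  assumes "(p, q) \<in> up_arcs k"
  obtains a where "p = 2 * a" "q = 2 * a + 1" "a < 2 * m"
    | a where "p = 2 * (a + 1)" "q = 2 * a + 1" "a + 1 < 2 * m"
    | "p = 2 * 0" "q = 2 * (2 * m - 1) + 1"
proof -
  have pq: "p < 4 * m" "q = p + 1 \<or> p = q + 1 \<or> p = 0 \<and> q = 4 * m - 1"
    and ev: "even p" "odd q"
    using assms m by (auto simp: up_arcs_iff k)
  obtain a where "q = 2 * a + 1" using ev(2) by (rule oddE)
  with pq m that(1,2)[of a] that(3) show thesis by auto
qed

text \<open>The \<alpha>-property: labels at even positions are below 2m, labels at odd positions
  are at least 2m.\<close>

lemma zigzag_up:
  assumes "(p, q) \<in> up_arcs k"
  shows "zigzag k p < zigzag k q"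
  using assms m by (cases rule: up_arcs_cases) (simp_all only: zigzag_even zigzag_odd, auto simp: k)

text \<open>As \<open>a\<close> grows, the rising arcs have the even differences 4m to 2m + 2, then
  the odd ones 2m - 1 to 1; the falling arcs have the odd differences 4m - 1 to 2m + 1, then the
  even ones 2m - 2 to 2; the closing arc has 2m. No value recurs, and solving for \<open>a\<close>
  gives the formula.\<close>

lemma zigzag_up_diff_determines_start:
  assumes "(p, q) \<in> up_arcs k" "zigzag k q = zigzag k p + e"
  shows "p = (if e = 2 * m then 0
    else if odd e \<and> e < 2 * m then 2 * (2 * m - e div 2 - 1) else 2 * (2 * m - e div 2))"
  using assms(1)
proof (cases rule: up_arcs_cases)
  case (1 a)
  then have "e = (if a < m then 2 * (2 * m - a) else 2 * (2 * m - 1 - a) + 1)"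
    using assms(2) by (simp only: zigzag_even zigzag_odd) (auto simp: k)
  then show ?thesis using 1 by (auto split: if_splits)
next
  case (2 a)
  then have "e = (if a < m then 2 * (2 * m - 1 - a) + 1 else 2 * (2 * m - 1 - a))"
    using assms(2) by (simp only: zigzag_even zigzag_odd) (auto simp: k)
  then show ?thesis using 2 by (auto split: if_splits)
next
  case 3
  then have "e = 2 * m"
    using assms(2) m by (simp only: zigzag_even zigzag_odd) (auto simp: k)
  then show ?thesis using 3 by simp
qed

text \<open>Equality of the two differences is stated additively to avoid truncated
  subtraction.\<close>

lemma zigzag_up_diff_unique:
  assumes "(p, q) \<in> up_arcs k" "(p', q') \<in> up_arcs k"
    and "zigzag k q + zigzag k p' = zigzag k q' + zigzag k p"
  shows "p = p'"
proof -
  define e where "e = zigzag k q - zigzag k p"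
  have "zigzag k q = zigzag k p + e" "zigzag k q' = zigzag k p' + e"
    using zigzag_up[OF assms(1)] assms(3) by (simp_all add: e_def)
  then show ?thesis
    using zigzag_up_diff_determines_start[OF assms(1)] zigzag_up_diff_determines_start[OF assms(2)]
    by metis
qed

lemma zigzag_up_diff_exists:
  assumes "1 \<le> e" "e \<le> k"
  shows "\<exists>p q. (p, q) \<in> up_arcs k \<and> zigzag k q = zigzag k p + e"
proof -
  have wit: ?thesis if "(p, q) \<in> up_arcs k" "zigzag k q = zigzag k p + e" for p q
    using that by blast
  \<comment> \<open>Parity of \<open>e\<close> and its size relative to 2m select the type of arc.
    In order, the five cases are: rising in the first half, closing, falling in the second half,
    falling in the first half, rising in the second half.\<close>
  obtain b where "e = 2 * b \<or> e = 2 * b + 1" by (metis evenE oddE)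
  then consider "e = 2 * b" "m < b" | "e = 2 * b" "m = b" | "e = 2 * b" "b < m"
    | "e = 2 * b + 1" "m \<le> b" | "e = 2 * b + 1" "b < m"
    by linarith
  then show ?thesis
  proof cases
    case 1
    then show ?thesis using assms m
      by (intro wit[of "2 * (2 * m - b)" "2 * (2 * m - b) + 1"])
        (auto simp: up_arcs_iff zigzag_def k)
  next
    case 2
    then show ?thesis using assms m
      by (intro wit[of 0 "2 * (2 * m - 1) + 1"]) (auto simp: up_arcs_iff zigzag_def k)
  next
    case 3
    then show ?thesis using assms m
      by (intro wit[of "2 * (2 * m - b)" "2 * (2 * m - b - 1) + 1"])
        (auto simp: up_arcs_iff zigzag_def k)
  next
    case 4
    then show ?thesis using assms m
      by (intro wit[of "2 * (2 * m - b)" "2 * (2 * m - b - 1) + 1"])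
        (auto simp: up_arcs_iff zigzag_def k)
  next
    case 5
    then show ?thesis using assms m
      by (intro wit[of "2 * (2 * m - b - 1)" "2 * (2 * m - b - 1) + 1"])
        (auto simp: up_arcs_iff zigzag_def k)
  qed
qed

end

section \<open>Translations and differences modulo n\<close>

lemma nat_mod_eq_iff_dvd_int: "x mod n = y mod n \<longleftrightarrow> int n dvd int x - int y"
  for x y n :: nat
  by (metis mod_eq_dvd_iff of_nat_eq_iff of_nat_mod)

lemma dvd_int_imp_zero: "\<bar>z\<bar> < n \<Longrightarrow> n dvd z \<Longrightarrow> z = 0" for z n :: int
  using dvd_imp_le_int[of z n] by linarith

lemma add_mod_left_cancel:
  fixes i a b n :: nat
  assumes "(i + a) mod n = (i + b) mod n" "a < n" "b < n"
  shows "a = b"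
proof -
  have "int n dvd int a - int b"
    using assms(1) unfolding nat_mod_eq_iff_dvd_int by simp
  moreover have "\<bar>int a - int b\<bar> < int n" using assms(2,3) by linarith
  ultimately have "int a - int b = 0" by (rule dvd_int_imp_zero[rotated])
  then show ?thesis by simp
qed

lemma add_mod_surj:
  fixes i u n :: nat
  assumes "u < n"
  shows "\<exists>a < n. u = (i + a) mod n"
proof (intro exI conjI)
  \<comment> \<open>The multiple \<open>n * i\<close> is at least \<open>i\<close>, so the residue
    of \<open>u - i\<close> is obtained without truncation.\<close>
  show "(u + n * i - i) mod n < n" using assms by simp
  have "(i + (u + n * i - i) mod n) mod n = (i + (u + n * i - i)) mod n"
    by (rule mod_add_right_eq)
  also have "i + (u + n * i - i) = u + n * i" using assms by (cases n) simp_all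
  finally show "u = (i + (u + n * i - i) mod n) mod n" using assms by simp
qed

text \<open>The two cyclic distances between \<open>y\<close> and \<open>z\<close> are positive and
  sum to \<open>2 * h + 1\<close>, so one of them is at most \<open>h\<close>.\<close>

lemma half_difference_exists:
  fixes h t y z :: nat
  assumes t: "t = 2 * h + 1" and "y < t" "z < t" "y \<noteq> z"
  shows "\<exists>d. 1 \<le> d \<and> d \<le> h \<and> (z = (y + d) mod t \<or> y = (z + d) mod t)"
proof -
  have *: "\<exists>d. 1 \<le> d \<and> d \<le> h \<and> (z = (y + d) mod t \<or> y = (z + d) mod t)"
    if "y < z" "z < t" for y z
  proof (cases "z - y \<le> h")
    case True
    then show ?thesis using that by (intro exI[of _ "z - y"]) simp
  next
    case False
    then have "z + (t + y - z) = y + t" using that by simp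
    then have "y = (z + (t + y - z)) mod t" using that by simp
    moreover have "1 \<le> t + y - z" "t + y - z \<le> h" using that False t by linarith+
    ultimately show ?thesis by blast
  qed
  then show ?thesis using assms by (metis nat_neq_iff)
qed

section \<open>Lifted cycles and their oriented edges\<close>

definition lift :: "nat \<Rightarrow> nat \<Rightarrow> nat \<Rightarrow> nat \<Rightarrow> nat \<Rightarrow> nat \<Rightarrow> nat \<times> nat" where
  "lift k t i d x p =
    ((i + zigzag k p) mod (k + 1), (x + (if odd p then d else 0)) mod t)"

text \<open>The tail \<open>v\<close> sits at an even position, where the second coordinate is the
  index of the lift itself; hence no separate index occurs.\<close>

definition step :: "nat \<Rightarrow> nat \<Rightarrow> nat \<Rightarrow> nat \<Rightarrow> nat \<times> nat \<Rightarrow> nat \<times> nat \<Rightarrow> bool" where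
  "step k t i d v w \<longleftrightarrow> snd v < t \<and> snd w = (snd v + d) mod t \<and>
    (\<exists>(p, q) \<in> up_arcs k. fst v = (i + zigzag k p) mod (k + 1) \<and> fst w = (i + zigzag k q) mod (k + 1))"

definition factor :: "nat \<Rightarrow> nat \<Rightarrow> nat \<Rightarrow> nat \<Rightarrow> (nat \<times> nat) pair_pre_digraph" where
  "factor k t i d = cycle_union k {..<t} (lift k t i d)"

lemma parcs_factor_iff:
  assumes "even k"
  shows "(v, w) \<in> parcs (factor k t i d) \<longleftrightarrow> step k t i d v w \<or> step k t i d w v"
proof
  assume "(v, w) \<in> parcs (factor k t i d)"
  then obtain x p q where x: "x < t" and vw: "v = lift k t i d x p" "w = lift k t i d x q"
    and pq: "(p, q) \<in> parcs (cycle_graph k)"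
    by (auto simp: factor_def parcs_cycle_union)
  have *: "step k t i d (lift k t i d x p) (lift k t i d x q)" if "(p, q) \<in> up_arcs k" for p q
    unfolding step_def
    by (intro conjI bexI[OF _ that]) (use x that in \<open>auto simp: lift_def up_arcs_def\<close>)
  show "step k t i d v w \<or> step k t i d w v"
    using cycle_graph_arc_cases[OF assms pq] * vw by blast
next
  have *: "\<exists>x p q. x < t \<and> v = lift k t i d x p \<and> w = lift k t i d x q \<and>
    (p, q) \<in> parcs (cycle_graph k)" if "step k t i d v w" for v w
  proof -
    from that obtain p q where "(p, q) \<in> up_arcs k" "fst v = (i + zigzag k p) mod (k + 1)"
      "fst w = (i + zigzag k q) mod (k + 1)" "snd v < t" "snd w = (snd v + d) mod t"
      unfolding step_def by auto
    then show ?thesis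
      by (intro exI[of _ "snd v"] exI[of _ p] exI[of _ q])
        (auto simp: lift_def up_arcs_def prod_eq_iff)
  qed
  assume "step k t i d v w \<or> step k t i d w v"
  then show "(v, w) \<in> parcs (factor k t i d)"
    unfolding factor_def parcs_cycle_union
    using *[of v w] *[of w v] cycle_graph_arcD(3) by blast
qed

context
  fixes k m t h :: nat
  assumes k: "k = 4 * m" and m: "m > 0" and t: "t = 2 * h + 1"
begin

text \<open>Labels are distinct and at most \<open>k\<close>, so the first coordinate determines the
  position; its parity then fixes the shift, and the second coordinate gives the index.\<close>

lemma lift_inj:
  assumes "x < t" "y < t" "p < k" "q < k" "lift k t i d x p = lift k t i d y q"
  shows "x = y \<and> p = q"
proof -
  have "zigzag k p = zigzag k q"
    using assms add_mod_left_cancel[of i "zigzag k p" "k + 1" "zigzag k q"] zigzag_le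
    by (simp add: lift_def less_Suc_eq_le)
  then have pq: "p = q" using inj_onD[OF inj_on_zigzag[OF k m]] assms by simp
  then have "((if odd p then d else 0) + x) mod t = ((if odd p then d else 0) + y) mod t"
    using assms by (simp add: lift_def add.commute)
  then show ?thesis using pq add_mod_left_cancel assms by blast
qed

lemma disjoint_cycles_lift: "disjoint_cycles k {..<t} (lift k t i d)"
proof
  show "x = y \<and> p = q" if "x \<in> {..<t}" "y \<in> {..<t}" "p < k" "q < k"
    "lift k t i d x p = lift k t i d y q" for x p y q
    using lift_inj that by simp
qed (use k m in simp_all)

text \<open>The labels hit every residue except 3m, and at each fixed position the second coordinate
  runs through a translate of all residues modulo \<open>t\<close>.\<close>

lemma pverts_factor:
  "pverts (factor k t i d) = ({..<k + 1} - {(i + 3 * m) mod (k + 1)}) \<times> {..<t}"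
proof -
  have fst_sub: "(i + zigzag k p) mod (k + 1) \<noteq> (i + 3 * m) mod (k + 1)" if "p < k" for p
  proof
    assume "(i + zigzag k p) mod (k + 1) = (i + 3 * m) mod (k + 1)"
    moreover have "zigzag k p \<in> {..k} - {3 * m}" using that image_zigzag[OF k m] by blast
    ultimately show False using add_mod_left_cancel[of i "zigzag k p" "k + 1" "3 * m"] k by auto
  qed
  show ?thesis
  proof (intro equalityI subsetI)
    fix v assume "v \<in> pverts (factor k t i d)"
    then show "v \<in> ({..<k + 1} - {(i + 3 * m) mod (k + 1)}) \<times> {..<t}"
      using fst_sub t by (auto simp: factor_def pverts_cycle_union lift_def simp del: mod_less)
  next
    fix v assume v: "v \<in> ({..<k + 1} - {(i + 3 * m) mod (k + 1)}) \<times> {..<t}"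
    then obtain a where a: "a < k + 1" "fst v = (i + a) mod (k + 1)"
      using add_mod_surj[of "fst v" "k + 1" i] by (metis DiffD1 lessThan_iff mem_Times_iff)
    then have "a \<in> zigzag k ` {..<k}" using v image_zigzag[OF k m] by auto
    then obtain p where p: "p < k" "a = zigzag k p" by auto
    obtain x where "x < t" "snd v = ((if odd p then d else 0) + x) mod t"
      using add_mod_surj[of "snd v" t] v by (metis lessThan_iff mem_Times_iff)
    moreover from this have "v = lift k t i d x p"
      using a p by (simp add: lift_def prod_eq_iff add.commute)
    ultimately show "v \<in> pverts (factor k t i d)"
      using p by (auto simp: factor_def pverts_cycle_union)
  qed
qed

lemma step_imp_arc:
  assumes "step k t i d v w" "1 \<le> d" "d \<le> h"
  shows "(v, w) \<in> parcs (tensor_product (complete_graph (k + 1)) (complete_graph t))"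
    and "(w, v) \<in> parcs (tensor_product (complete_graph (k + 1)) (complete_graph t))"
proof -
  from assms(1) obtain p q where pq: "(p, q) \<in> up_arcs k" "fst v = (i + zigzag k p) mod (k + 1)"
      "fst w = (i + zigzag k q) mod (k + 1)" and s: "snd v < t" "snd w = (snd v + d) mod t"
    unfolding step_def by auto
  have "p < k" "q < k" using pq(1) by (auto simp: up_arcs_def dest: cycle_graph_arcD)
  then have "fst v \<noteq> fst w"
    using pq add_mod_left_cancel[of i "zigzag k p" "k + 1" "zigzag k q"]
      zigzag_up[OF k m pq(1)] zigzag_le by (auto simp: less_Suc_eq_le)
  moreover have "snd v \<noteq> snd w"
    using s add_mod_left_cancel[of "snd v" 0 t d] assms(2,3) t by auto
  moreover have "fst v < k + 1" "fst w < k + 1" "snd w < t" using pq s t by simp_all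
  ultimately show "(v, w) \<in> parcs (tensor_product (complete_graph (k + 1)) (complete_graph t))"
    and "(w, v) \<in> parcs (tensor_product (complete_graph (k + 1)) (complete_graph t))"
    using s by (auto simp: tensor_product_def complete_graph_def prod_eq_iff intro!: exI)
qed

text \<open>Take the arc whose label difference is the residue of \<open>v - u\<close>; the
  translation \<open>i\<close> is then chosen to move its starting label to
  \<open>u\<close>.\<close>

lemma step_exists:
  assumes "u < k + 1" "v < k + 1" "u \<noteq> v" "y < t" "z = (y + d) mod t"
  shows "\<exists>i < k + 1. step k t i d (u, y) (v, z)"
proof -
  obtain e where "e < k + 1" and v: "v = (u + e) mod (k + 1)"
    using add_mod_surj[OF assms(2)] by auto
  moreover from v have "e \<noteq> 0" using assms(1,3) by (cases "e = 0") auto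
  ultimately have e: "1 \<le> e" "e \<le> k" by auto
  obtain p q where pq: "(p, q) \<in> up_arcs k" "zigzag k q = zigzag k p + e"
    using zigzag_up_diff_exists[OF k m e(1,2)] by auto
  obtain i where i: "i < k + 1" and u: "u = (i + zigzag k p) mod (k + 1)"
    using add_mod_surj[OF assms(1)] by (metis add.commute)
  then have "v = (i + zigzag k q) mod (k + 1)"
    using v pq(2) by (metis add.assoc mod_add_left_eq)
  then have "step k t i d (u, y) (v, z)"
    using u pq assms by (auto simp: step_def intro!: bexI[OF _ pq(1)])
  then show ?thesis using i by blast
qed

lemma step_unique:
  assumes "step k t i d v w" "step k t i' d' v w" "i < k + 1" "i' < k + 1" "d \<le> h" "d' \<le> h"
  shows "i = i' \<and> d = d'"
proof
  from assms(1) obtain p q where pq: "(p, q) \<in> up_arcs k" "fst v = (i + zigzag k p) mod (k + 1)"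
      "fst w = (i + zigzag k q) mod (k + 1)" and s: "snd w = (snd v + d) mod t"
    unfolding step_def by auto
  from assms(2) obtain p' q' where pq': "(p', q') \<in> up_arcs k" "fst v = (i' + zigzag k p') mod (k + 1)"
      "fst w = (i' + zigzag k q') mod (k + 1)" and s': "snd w = (snd v + d') mod t"
    unfolding step_def by auto
  show "d = d'" using s s' add_mod_left_cancel[of "snd v" d t d'] assms t by simp
  have "p < k" "q < k" "p' < k" "q' < k"
    using pq(1) pq'(1) by (auto simp: up_arcs_def dest: cycle_graph_arcD)
  then have le: "zigzag k q \<le> k" "zigzag k q' \<le> k" by (auto intro: zigzag_le)
  have "int (k + 1) dvd int (i + zigzag k q) - int (i' + zigzag k q')"
    "int (k + 1) dvd int (i + zigzag k p) - int (i' + zigzag k p')"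
    using pq pq' unfolding nat_mod_eq_iff_dvd_int[symmetric] by simp_all
  \<comment> \<open>Subtraction cancels the translations and leaves the difference of two label
    differences, both between 1 and \<open>k\<close>. A multiple of \<open>k + 1\<close> that small
    is zero.\<close>
  then have "int (k + 1) dvd (int (i + zigzag k q) - int (i' + zigzag k q'))
      - (int (i + zigzag k p) - int (i' + zigzag k p'))"
    by (rule dvd_diff)
  then have "(int (i + zigzag k q) - int (i' + zigzag k q'))
      - (int (i + zigzag k p) - int (i' + zigzag k p')) = 0"
    by (rule dvd_int_imp_zero[rotated])
      (use zigzag_up[OF k m pq(1)] zigzag_up[OF k m pq'(1)] le in auto)
  then have "p = p'" using zigzag_up_diff_unique[OF k m pq(1) pq'(1)] by linarith
  then show "i = i'"
    using pq(2) pq'(2) assms(3,4) add_mod_left_cancel[of "zigzag k p" i "k + 1" i']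
    by (simp add: add.commute)
qed

text \<open>Going there and back would make \<open>d + d'\<close> a multiple of \<open>t\<close>,
  although it lies strictly between 0 and \<open>2 * h + 1\<close>.\<close>

lemma step_antisym:
  assumes "step k t i d v w" "step k t i' d' w v" "1 \<le> d" "d \<le> h" "d' \<le> h"
  shows False
proof -
  have "snd v < t" "snd v = (snd v + d + d') mod t"
    using assms(1,2) by (auto simp: step_def mod_add_left_eq)
  then show False
    using add_mod_left_cancel[of "snd v" 0 t "d + d'"] assms t by (simp add: add.assoc)
qed

section \<open>The partial factors and the factorization\<close>

lemma partial_cycle_factor_factor:
  assumes "i < k + 1" "1 \<le> d" "d \<le> h"
  shows "partial_cycle_factor k (complete_graph (k + 1)) (complete_graph t) (factor k t i d)"
proof -
  let ?G = "complete_graph (k + 1)" and ?H = "complete_graph t" and ?F = "factor k t i d"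
  interpret disjoint_cycles k "{..<t}" "lift k t i d" by (rule disjoint_cycles_lift)
  have F: "pair_graph ?F" unfolding factor_def by (rule pair_graph_cycle_union)
  then interpret F: pair_graph ?F .
  let ?j = "(i + 3 * m) mod (k + 1)"
  have verts: "pverts (tensor_product ?G ?H) - partite_set ?H ?j = pverts ?F"
    by (auto simp: pverts_factor tensor_product_def complete_graph_def partite_set_def)
  have "pair_wf_digraph (tensor_product ?G ?H)"
    by unfold_locales (auto simp: tensor_product_def complete_graph_def)
  then have "wf_digraph (with_proj (tensor_product ?G ?H))" by (simp add: wf_digraph_wp_iff)
  then have wf: "wf_digraph (with_proj (tensor_product ?G ?H) \<restriction> pverts ?F)"
    by (rule wf_digraph.wellformed_induce_subgraph)
  have "parcs ?F \<subseteq> parcs (tensor_product ?G ?H)"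
    using step_imp_arc[OF _ assms(2,3)] parcs_factor_iff[of k] k by auto
  then have "spanning (with_proj ?F) (with_proj (tensor_product ?G ?H) \<restriction> pverts ?F)"
    unfolding spanning_def subgraph_def compatible_def
    using wf F.wf_digraph by (auto simp: F.in_arcsD1 F.in_arcsD2)
  moreover have "?j \<in> pverts ?G" by (simp add: complete_graph_def)
  ultimately have "\<exists>j \<in> pverts ?G. spanning (with_proj ?F)
      (with_proj (tensor_product ?G ?H) \<restriction> (pverts (tensor_product ?G ?H) - partite_set ?H j))"
    unfolding verts[symmetric] by blast
  then show ?thesis
    using F scc_cycle_union_iso_cycle unfolding partial_cycle_factor_def factor_def by blast
qed

lemma partial_cycle_factorization_factors:
  "partial_cycle_factorization k (complete_graph (k + 1)) (complete_graph t)
    {factor k t i d | i d. i < k + 1 \<and> 1 \<le> d \<and> d \<le> h}"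
  unfolding partial_cycle_factorization_def
proof (intro conjI)
  let ?\<F> = "{factor k t i d | i d. i < k + 1 \<and> 1 \<le> d \<and> d \<le> h}"
  let ?T = "tensor_product (complete_graph (k + 1)) (complete_graph t)"
  have ev: "even k" using k by simp
  show "\<forall>F \<in> ?\<F>. partial_cycle_factor k (complete_graph (k + 1)) (complete_graph t) F"
    using partial_cycle_factor_factor by blast
  show "disjoint_family_on parcs ?\<F>"
  proof (unfold disjoint_family_on_def, intro ballI impI)
    fix F F' assume "F \<in> ?\<F>" "F' \<in> ?\<F>" and neq: "F \<noteq> F'"
    then obtain i d i' d' where
      F: "F = factor k t i d" "i < k + 1" "1 \<le> d" "d \<le> h" and
      F': "F' = factor k t i' d'" "i' < k + 1" "1 \<le> d'" "d' \<le> h" by blast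
    have False if "(v, w) \<in> parcs F" "(v, w) \<in> parcs F'" for v w
    proof -
      \<comment> \<open>A shared edge is oriented the same way in both factors by
        \<open>step_antisym\<close>, so \<open>step_unique\<close> identifies their
        parameters.\<close>
      have "step k t i d v w \<or> step k t i d w v" "step k t i' d' v w \<or> step k t i' d' w v"
        using that F(1) F'(1) parcs_factor_iff[OF ev] by auto
      then have "i = i' \<and> d = d'"
        using step_unique step_antisym F F' by metis
      then show False using neq F(1) F'(1) by simp
    qed
    then show "parcs F \<inter> parcs F' = {}" by auto
  qed
  show "(\<Union>F \<in> ?\<F>. parcs F) = parcs ?T"
  proof (intro equalityI subsetI)
    fix e assume "e \<in> (\<Union>F \<in> ?\<F>. parcs F)"
    then show "e \<in> parcs ?T"
      using step_imp_arc parcs_factor_iff[OF ev] by (cases e) blast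
  next
    fix e assume "e \<in> parcs ?T"
    then obtain u y v z where e: "e = ((u, y), (v, z))" "u < k + 1" "v < k + 1" "u \<noteq> v"
      "y < t" "z < t" "y \<noteq> z"
      by (auto simp: tensor_product_def complete_graph_def)
    \<comment> \<open>The end from which the other is reached by adding \<open>d\<close> becomes the
      tail, at an even position.\<close>
    then obtain d where d: "1 \<le> d" "d \<le> h" "z = (y + d) mod t \<or> y = (z + d) mod t"
      using half_difference_exists[OF t] by metis
    then obtain i where "i < k + 1" "step k t i d (u, y) (v, z) \<or> step k t i d (v, z) (u, y)"
      using step_exists e by metis
    then have "e \<in> parcs (factor k t i d)" using e parcs_factor_iff[OF ev] by auto
    then show "e \<in> (\<Union>F \<in> ?\<F>. parcs F)" using \<open>i < k + 1\<close> d by blast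
  qed
qed

end

theorem theorem3p1:
  fixes t k :: nat
  assumes "odd t" and "t \<ge> 3" and "k > 0" and "k mod 4 = 0"
  shows "\<exists>\<F>. partial_cycle_factorization k (complete_graph (k + 1)) (complete_graph t) \<F>"
proof -
  obtain h where t: "t = 2 * h + 1" using assms(1) by (rule oddE)
  obtain m where k: "k = 4 * m" using assms(4) by (auto simp: mod_eq_0_iff_dvd)
  have "m > 0" using assms(3) k by simp
  from partial_cycle_factorization_factors[OF k this t] show ?thesis by blast
qed

end
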